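(* Let $p,q,r,s,f,g:[t_0,+\infty)\to\mathbb{R}$ be continuous functions. Consider the nonhomogeneous linear system $$\phi' = p(t)\phi + q(t)\psi + f(t),\qquad \psi' = r(t)\phi + s(t)\psi + g(t),\qquad t\ge t_0, \tag{N}$$ and the corresponding homogeneous system $$\phi' = p(t)\phi + q(t)\psi,\qquad \psi' = r(t)\phi + s(t)\psi,\qquad t\ge t_0. \tag{H}$$ For $\lambda\in\mathbb{R}$ put $$\alpha_\lambda(t) = \exp\left\{\int_{t_0}^{t}p(\tau)\,d\tau\right\}\left[\lambda + \int_{t_0}^{t}\exp\left\{-\int_{t_0}^{\tau}p(\sigma)\,d\sigma\right\}f(\tau)\,d\tau\right],\qquad t\ge t_0.$$ Suppose that: (1) $q(t)\ge 0$ for all $t\ge t_0$; (2) for every $T>t_0$ there exist numbers $s_1,t_1,s_2,t_2$ with $T\le s_1<t_1\le s_2<t_2$ and $\lambda\in\mathbb{R}$ such that (2a) $(-1)^k\alpha_\lambda(t)\ge 0$ for all $t\in[s_k,t_k]$, $k=1,2$; (2b) $(-1)^k\left[r(t)\alpha_\lambda(t)+g(t)\right]\ge 0$ for all $t\in[s_k,t_k]$, $k=1,2$; (2c) the homogeneous system (H) is oscillatory on each of the intervals $[s_k,t_k]$, $k=1,2$. Then the nonhomogeneous system (N) is oscillatory.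
   Context: All functions and solutions are real-valued; solutions $(\phi(t),\psi(t))$ of the linear systems are defined on $[t_0,+\infty)$. A linear system of the form $\phi' = p(t)\phi + q(t)\psi + f(t)$, $\psi' = r(t)\phi + s(t)\psi + g(t)$, $t\ge t_0$, with continuous real-valued coefficients $p,q,r,s,f,g$ on $[t_0,+\infty)$ (nonhomogeneous, or homogeneous in the case $f\equiv g\equiv 0$) is called oscillatory if for each of its solutions $(\phi(t),\psi(t))$ the function $\phi(t)$ has arbitrarily large zeroes; otherwise it is called non oscillatory. It is called oscillatory on an interval $[a,b]\subset[t_0,+\infty)$ if for each of its solutions $(\phi(t),\psi(t))$ the function $\phi(t)$ has a zero on $[a,b]$. *)

theory Defs
  imports "HOL-Analysis.Analysis"
begin

text \<open>
  Coefficients and solutions are functions on the whole real line, but only their values on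
  \<open>{t0..}\<close> matter; at \<open>t0\<close> the derivative is the right-hand one. The homogeneous
  system is the case \<open>f = g = (\<lambda>_. 0)\<close>.
\<close>

definition is_solution ::
  "real \<Rightarrow> (real \<Rightarrow> real) \<Rightarrow> (real \<Rightarrow> real) \<Rightarrow> (real \<Rightarrow> real) \<Rightarrow> (real \<Rightarrow> real) \<Rightarrow>
   (real \<Rightarrow> real) \<Rightarrow> (real \<Rightarrow> real) \<Rightarrow> (real \<Rightarrow> real) \<Rightarrow> (real \<Rightarrow> real) \<Rightarrow> bool" where
  "is_solution t0 p q r s f g \<phi> \<psi> \<longleftrightarrow>
     (\<forall>t\<ge>t0.
        (\<phi> has_real_derivative (p t * \<phi> t + q t * \<psi> t + f t)) (at t within {t0..}) \<and>
        (\<psi> has_real_derivative (r t * \<phi> t + s t * \<psi> t + g t)) (at t within {t0..}))"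

definition oscillatory ::
  "real \<Rightarrow> (real \<Rightarrow> real) \<Rightarrow> (real \<Rightarrow> real) \<Rightarrow> (real \<Rightarrow> real) \<Rightarrow> (real \<Rightarrow> real) \<Rightarrow>
   (real \<Rightarrow> real) \<Rightarrow> (real \<Rightarrow> real) \<Rightarrow> bool" where
  "oscillatory t0 p q r s f g \<longleftrightarrow>
     (\<forall>\<phi> \<psi>. is_solution t0 p q r s f g \<phi> \<psi> \<longrightarrow> (\<forall>T\<ge>t0. \<exists>t\<ge>T. \<phi> t = 0))"

text \<open>The solutions in the next definition are solutions on all of \<open>{t0..}\<close>.\<close>

definition oscillatory_on ::
  "real \<Rightarrow> (real \<Rightarrow> real) \<Rightarrow> (real \<Rightarrow> real) \<Rightarrow> (real \<Rightarrow> real) \<Rightarrow> (real \<Rightarrow> real) \<Rightarrow>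
   (real \<Rightarrow> real) \<Rightarrow> (real \<Rightarrow> real) \<Rightarrow> real \<Rightarrow> real \<Rightarrow> bool" where
  "oscillatory_on t0 p q r s f g a b \<longleftrightarrow>
     (\<forall>\<phi> \<psi>. is_solution t0 p q r s f g \<phi> \<psi> \<longrightarrow> (\<exists>t\<in>{a..b}. \<phi> t = 0))"

definition alpha :: "real \<Rightarrow> (real \<Rightarrow> real) \<Rightarrow> (real \<Rightarrow> real) \<Rightarrow> real \<Rightarrow> real \<Rightarrow> real" where
  "alpha t0 p f l t =
     exp (integral {t0..t} p) *
     (l + integral {t0..t} (\<lambda>\<tau>. exp (- integral {t0..\<tau>} p) * f \<tau>))"

end

theory Submission
  imports Defs
begin

text \<open>
  Since \<open>alpha' = p alpha + f\<close>, subtracting it from the first component of a solution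
  \<open>(\<phi>, \<psi>)\<close> removes \<open>f\<close> and replaces \<open>g\<close> by \<open>h = r alpha + g\<close>. If \<open>\<phi>\<close> is eventually positive
  (else negate everything), then on one of the given intervals
  \<open>u = \<phi> - alpha > 0\<close> and \<open>h \<le> 0\<close>. Let \<open>(\<phi>0, \<psi>0)\<close> be the solution of the homogeneous system that
  agrees with \<open>(u, \<psi>)\<close> at the left endpoint, and \<open>W = \<phi>0 \<psi> - u \<psi>0\<close>. Then
  \<open>W' = (p + s) W + \<phi>0 h\<close> gives \<open>W \<le> 0\<close> up to the first zero of \<open>\<phi>0\<close>, so
  \<open>(\<phi>0 / u)' = - q W / u\<^sup>2 \<ge> 0\<close> and \<open>\<phi>0 / u \<ge> 1\<close> there: \<open>\<phi>0\<close> has no zero on the interval.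
\<close>

section \<open>Calculus on a half-line\<close>

lemma at_within_atLeast_interior:
  fixes t :: real
  assumes "t0 < t"
  shows "at t within {t0..} = at t"
  using assms by (intro at_within_interior) (simp add: interior_real_atLeast)

text \<open>The fundamental theorem of calculus is applied on the compact interval
  \<open>{t0..t+1}\<close>. Its right end lies beyond \<open>t\<close>, so near \<open>t\<close> it
  coincides with the half-line and the one-sided derivative at \<open>t0\<close> is covered
  too.\<close>

lemma integral_has_real_derivative_atLeast:
  fixes h :: "real \<Rightarrow> real"
  assumes "continuous_on {t0..} h" "t0 \<le> t"
  shows "((\<lambda>x. integral {t0..x} h) has_real_derivative h t) (at t within {t0..})"
proof -
  have "((\<lambda>x. integral {t0..x} h) has_real_derivative h t) (at t within {t0..t+1})"
    using assms by (intro integral_has_real_derivative continuous_on_subset[OF assms(1)]) auto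
  moreover have "at t within {t0..t+1} = at t within {t0..}"
    by (rule at_within_nhd[of _ "{..<t+1}"]) auto
  ultimately show ?thesis by simp
qed

lemma integral_power_shift:
  fixes t0 t :: real
  assumes "t0 \<le> t"
  shows "((\<lambda>x. (x - t0) ^ n) has_integral (t - t0) ^ Suc n / real (Suc n)) {t0..t}"
proof -
  have "((\<lambda>x. (x - t0) ^ n) has_integral
      (t - t0) ^ Suc n / real (Suc n) - (t0 - t0) ^ Suc n / real (Suc n)) {t0..t}"
    using assms
    by (intro fundamental_theorem_of_calculus)
       (auto intro!: derivative_eq_intros simp: has_real_derivative_iff_has_vector_derivative[symmetric]
             simp del: power_Suc)
  then show ?thesis by simp
qed

section \<open>Existence for the homogeneous system by Picard iteration\<close>

text \<open>These are the increments between successive Picard iterates: by linearity each is the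
  integral operator applied to the previous one, and their sum over \<open>n\<close> is the solution
  with value \<open>(x, y)\<close> at \<open>t0\<close>.\<close>

primrec picard_term ::
  "real \<Rightarrow> (real \<Rightarrow> real) \<Rightarrow> (real \<Rightarrow> real) \<Rightarrow> (real \<Rightarrow> real) \<Rightarrow> (real \<Rightarrow> real) \<Rightarrow> real \<Rightarrow> real \<Rightarrow>
   nat \<Rightarrow> real \<Rightarrow> real \<times> real" where
  "picard_term t0 p q r s x y 0 = (\<lambda>_. (x, y))"
| "picard_term t0 p q r s x y (Suc n) = (\<lambda>t.
     (integral {t0..t} (\<lambda>\<tau>. p \<tau> * fst (picard_term t0 p q r s x y n \<tau>)
        + q \<tau> * snd (picard_term t0 p q r s x y n \<tau>)),
      integral {t0..t} (\<lambda>\<tau>. r \<tau> * fst (picard_term t0 p q r s x y n \<tau>)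
        + s \<tau> * snd (picard_term t0 p q r s x y n \<tau>))))"

lemma continuous_on_picard_term:
  assumes "continuous_on {t0..} p" "continuous_on {t0..} q"
    and "continuous_on {t0..} r" "continuous_on {t0..} s"
  shows "continuous_on {t0..} (picard_term t0 p q r s x y n)"
proof (induction n)
  case 0
  show ?case by (simp add: continuous_on_const)
next
  case (Suc n)
  have *: "continuous_on {t0..} (\<lambda>t. integral {t0..t} (\<lambda>\<tau>.
      c \<tau> * fst (picard_term t0 p q r s x y n \<tau>) + d \<tau> * snd (picard_term t0 p q r s x y n \<tau>)))"
    if "continuous_on {t0..} c" "continuous_on {t0..} d" for c d
    using that
    by (intro DERIV_continuous_on[OF integral_has_real_derivative_atLeast])
       (auto intro!: continuous_intros Suc)
  show ?case
    unfolding picard_term.simps by (intro continuous_on_Pair * assms)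
qed

text \<open>Each integration turns \<open>(t - t0) ^ n\<close> into
  \<open>(t - t0) ^ Suc n / Suc n\<close>, which builds up the factorial, and the two products in a
  row of the system contribute the factor \<open>2 * M\<close>. As either row mixes both components,
  the two bounds are proved in one induction.\<close>

lemma picard_term_bound:
  assumes cont: "continuous_on {t0..} p" "continuous_on {t0..} q"
      "continuous_on {t0..} r" "continuous_on {t0..} s"
    and M: "\<And>t. t \<in> {t0..b} \<Longrightarrow> \<bar>p t\<bar> \<le> M \<and> \<bar>q t\<bar> \<le> M \<and> \<bar>r t\<bar> \<le> M \<and> \<bar>s t\<bar> \<le> M"
    and "t \<in> {t0..b}"
  shows "\<bar>fst (picard_term t0 p q r s x y n t)\<bar> \<le> (\<bar>x\<bar> + \<bar>y\<bar>) * ((2 * M) ^ n / fact n * (t - t0) ^ n)"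
    and "\<bar>snd (picard_term t0 p q r s x y n t)\<bar> \<le> (\<bar>x\<bar> + \<bar>y\<bar>) * ((2 * M) ^ n / fact n * (t - t0) ^ n)"
  using \<open>t \<in> {t0..b}\<close>
proof (induction n arbitrary: t)
  case 0
  {
    case 1
    show ?case by simp
  next
    case 2
    show ?case by simp
  }
next
  case (Suc n)
  let ?u = "picard_term t0 p q r s x y n"
  have step: "\<bar>integral {t0..t} (\<lambda>\<tau>. c \<tau> * fst (?u \<tau>) + d \<tau> * snd (?u \<tau>))\<bar>
      \<le> (\<bar>x\<bar> + \<bar>y\<bar>) * ((2 * M) ^ Suc n / fact (Suc n) * (t - t0) ^ Suc n)"
    if c: "continuous_on {t0..} c" "\<And>t. t \<in> {t0..b} \<Longrightarrow> \<bar>c t\<bar> \<le> M"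
      and d: "continuous_on {t0..} d" "\<And>t. t \<in> {t0..b} \<Longrightarrow> \<bar>d t\<bar> \<le> M"
      and t: "t \<in> {t0..b}" for c d t
  proof -
    have "continuous_on {t0..t} (\<lambda>\<tau>. c \<tau> * fst (?u \<tau>) + d \<tau> * snd (?u \<tau>))"
      by (rule continuous_on_subset[of "{t0..}"])
         (auto intro!: continuous_intros continuous_on_picard_term cont c d)
    then have int: "(\<lambda>\<tau>. c \<tau> * fst (?u \<tau>) + d \<tau> * snd (?u \<tau>)) integrable_on {t0..t}"
      by (rule integrable_continuous_real)
    have hi: "((\<lambda>\<tau>. 2 * M * (\<bar>x\<bar> + \<bar>y\<bar>) * ((2 * M) ^ n / fact n) * (\<tau> - t0) ^ n) has_integral
        2 * M * (\<bar>x\<bar> + \<bar>y\<bar>) * ((2 * M) ^ n / fact n) * ((t - t0) ^ Suc n / real (Suc n))) {t0..t}"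
      using t by (intro has_integral_mult_right integral_power_shift) auto
    have "norm (integral {t0..t} (\<lambda>\<tau>. c \<tau> * fst (?u \<tau>) + d \<tau> * snd (?u \<tau>)))
        \<le> integral {t0..t} (\<lambda>\<tau>. 2 * M * (\<bar>x\<bar> + \<bar>y\<bar>) * ((2 * M) ^ n / fact n) * (\<tau> - t0) ^ n)"
    proof (rule integral_norm_bound_integral[OF int])
      fix \<tau> assume "\<tau> \<in> {t0..t}"
      then have \<tau>: "\<tau> \<in> {t0..b}" using t by auto
      let ?B = "(\<bar>x\<bar> + \<bar>y\<bar>) * ((2 * M) ^ n / fact n * (\<tau> - t0) ^ n)"
      have "\<bar>c \<tau>\<bar> * \<bar>fst (?u \<tau>)\<bar> \<le> M * ?B" "\<bar>d \<tau>\<bar> * \<bar>snd (?u \<tau>)\<bar> \<le> M * ?B"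
        by (intro mult_mono c d Suc \<tau> abs_ge_zero; use c(2)[OF \<tau>] in linarith)+
      then have "norm (c \<tau> * fst (?u \<tau>) + d \<tau> * snd (?u \<tau>)) \<le> 2 * (M * ?B)"
        using abs_triangle_ineq[of "c \<tau> * fst (?u \<tau>)" "d \<tau> * snd (?u \<tau>)"]
        by (simp add: abs_mult)
      then show "norm (c \<tau> * fst (?u \<tau>) + d \<tau> * snd (?u \<tau>))
          \<le> 2 * M * (\<bar>x\<bar> + \<bar>y\<bar>) * ((2 * M) ^ n / fact n) * (\<tau> - t0) ^ n"
        by (simp only: mult_ac)
    qed (use hi in blast)
    also have "\<dots> = (\<bar>x\<bar> + \<bar>y\<bar>) * ((2 * M) ^ Suc n / fact (Suc n) * (t - t0) ^ Suc n)"
      using integral_unique[OF hi] by (simp add: divide_simps)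
    finally show ?thesis by simp
  qed
  {
    case 1
    then show ?case using step[of p q t] M cont by simp
  next
    case 2
    then show ?case using step[of r s t] M cont by simp
  }
qed

text \<open>The Picard series may be differentiated term by term: the derivative of term
  \<open>Suc n\<close> is the coefficient matrix applied to term \<open>n\<close>, so the
  differentiated series is the matrix applied to the series itself.\<close>

lemma linear_ivp_at_start:
  assumes cont: "continuous_on {t0..} p" "continuous_on {t0..} q"
      "continuous_on {t0..} r" "continuous_on {t0..} s"
  obtains \<phi> \<psi> where "is_solution t0 p q r s (\<lambda>_. 0) (\<lambda>_. 0) \<phi> \<psi>" "\<phi> t0 = x" "\<psi> t0 = y"
proof -
  let ?u = "picard_term t0 p q r s x y"
  define \<phi> where "\<phi> = (\<lambda>t. \<Sum>n. fst (?u n t))"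
  define \<psi> where "\<psi> = (\<lambda>t. \<Sum>n. snd (?u n t))"
  have deriv: "(\<phi> has_real_derivative p t * \<phi> t + q t * \<psi> t) (at t within {t0..}) \<and>
               (\<psi> has_real_derivative r t * \<phi> t + s t * \<psi> t) (at t within {t0..})"
    if t: "t0 \<le> t" for t
  proof -
    \<comment> \<open>Differentiability at \<open>t\<close> is a local matter; a compact interval
      reaching past \<open>t\<close> bounds the coefficients without changing the derivative at
      \<open>t\<close>.\<close>
    define b where "b = t + 1"
    have "\<exists>M. \<forall>t\<in>{t0..b}. \<bar>c t\<bar> \<le> M" if "continuous_on {t0..} c" for c :: "real \<Rightarrow> real"
    proof -
      have "compact (c ` {t0..b})"
        by (intro compact_continuous_image continuous_on_subset[OF that]) auto
      then have "bounded (c ` {t0..b})" by (rule compact_imp_bounded)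
      then show ?thesis by (auto simp: bounded_iff)
    qed
    then obtain Mp Mq Mr Ms where
      "\<forall>t\<in>{t0..b}. \<bar>p t\<bar> \<le> Mp" "\<forall>t\<in>{t0..b}. \<bar>q t\<bar> \<le> Mq"
      "\<forall>t\<in>{t0..b}. \<bar>r t\<bar> \<le> Mr" "\<forall>t\<in>{t0..b}. \<bar>s t\<bar> \<le> Ms"
      using cont by metis
    then obtain M where
      M: "\<And>t. t \<in> {t0..b} \<Longrightarrow> \<bar>p t\<bar> \<le> M \<and> \<bar>q t\<bar> \<le> M \<and> \<bar>r t\<bar> \<le> M \<and> \<bar>s t\<bar> \<le> M"
      using that[of "max (max Mp Mq) (max Mr Ms)"] by (simp add: max.coboundedI1 max.coboundedI2)
    have "0 \<le> M" using M[of t] t by (auto simp: b_def)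
    \<comment> \<open>The bound on the terms taken at the far end \<open>b\<close>: an exponential
      series, hence a summable majorant on the whole interval.\<close>
    define B where "B n = (\<bar>x\<bar> + \<bar>y\<bar>) * ((2 * M * (b - t0)) ^ n / fact n)" for n
    have sumB: "summable B"
      unfolding B_def using summable_exp[of "2 * M * (b - t0)"]
      by (intro summable_mult) (simp add: divide_inverse mult.commute)
    have uB: "\<bar>fst (?u n \<tau>)\<bar> \<le> B n" "\<bar>snd (?u n \<tau>)\<bar> \<le> B n" if \<tau>: "\<tau> \<in> {t0..b}" for n \<tau>
    proof -
      have "(\<bar>x\<bar> + \<bar>y\<bar>) * ((2 * M) ^ n / fact n * (\<tau> - t0) ^ n) \<le>
          (\<bar>x\<bar> + \<bar>y\<bar>) * ((2 * M) ^ n / fact n * (b - t0) ^ n)"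
        using \<tau> \<open>0 \<le> M\<close> by (intro mult_left_mono power_mono) auto
      also have "\<dots> = B n" by (simp add: B_def power_mult_distrib)
      finally have le: "(\<bar>x\<bar> + \<bar>y\<bar>) * ((2 * M) ^ n / fact n * (\<tau> - t0) ^ n) \<le> B n" .
      show "\<bar>fst (?u n \<tau>)\<bar> \<le> B n" "\<bar>snd (?u n \<tau>)\<bar> \<le> B n"
        using picard_term_bound[OF cont M \<tau>] le order.trans by blast+
    qed
    have summ: "summable (\<lambda>n. fst (?u n \<tau>))" "summable (\<lambda>n. snd (?u n \<tau>))"
      if "\<tau> \<in> {t0..b}" for \<tau>
      by (rule summable_comparison_test'[OF sumB, of 0]; use uB[OF that] in simp)+
    \<comment> \<open>Both equations at once: \<open>w\<close> stands for one component of the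
      terms, and \<open>c\<close>, \<open>d\<close> for the matching row of coefficients.\<close>
    have component: "((\<lambda>t. \<Sum>n. w n t) has_real_derivative c t * \<phi> t + d t * \<psi> t) (at t within {t0..})"
      if w0: "\<And>t. w 0 t = z"
        and wSuc: "\<And>n t. w (Suc n) t = integral {t0..t} (\<lambda>\<tau>. c \<tau> * fst (?u n \<tau>) + d \<tau> * snd (?u n \<tau>))"
        and wsum: "\<And>\<tau>. \<tau> \<in> {t0..b} \<Longrightarrow> summable (\<lambda>n. w n \<tau>)"
        and c: "continuous_on {t0..} c" "\<And>t. t \<in> {t0..b} \<Longrightarrow> \<bar>c t\<bar> \<le> M"
        and d: "continuous_on {t0..} d" "\<And>t. t \<in> {t0..b} \<Longrightarrow> \<bar>d t\<bar> \<le> M"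
      for w :: "nat \<Rightarrow> real \<Rightarrow> real" and z c d
    proof -
      \<comment> \<open>Term 0 is constant and has derivative 0, so the differentiated series is
        shifted by one index; its majorant \<open>B'\<close> is shifted likewise.\<close>
      define w' where "w' n t = (case n of 0 \<Rightarrow> 0 | Suc m \<Rightarrow> c t * fst (?u m t) + d t * snd (?u m t))"
        for n t
      define B' where "B' n = (case n of 0 \<Rightarrow> 0 | Suc m \<Rightarrow> 2 * M * B m)" for n
      have der: "(w n has_real_derivative w' n \<tau>) (at \<tau> within {t0..b})" if "\<tau> \<in> {t0..b}" for n \<tau>
      proof (cases n)
        case 0
        have "w 0 = (\<lambda>_. z)" using w0 by auto
        then show ?thesis using 0 by (simp add: w'_def)
      next
        case (Suc m)
        have "(w n has_real_derivative w' n \<tau>) (at \<tau> within {t0..})"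
          unfolding Suc wSuc[abs_def] w'_def nat.case using that
          by (intro integral_has_real_derivative_atLeast)
             (auto intro!: continuous_intros continuous_on_picard_term cont c d)
        then show ?thesis by (rule DERIV_subset) auto
      qed
      have "uniform_limit {t0..b} (\<lambda>n \<tau>. \<Sum>i<n. w' i \<tau>) (\<lambda>\<tau>. suminf (\<lambda>i. w' i \<tau>)) sequentially"
      proof (rule Weierstrass_m_test)
        show "norm (w' n \<tau>) \<le> B' n" if \<tau>: "\<tau> \<in> {t0..b}" for n \<tau>
        proof (cases n)
          case (Suc m)
          have "\<bar>c \<tau>\<bar> * \<bar>fst (?u m \<tau>)\<bar> \<le> M * B m" "\<bar>d \<tau>\<bar> * \<bar>snd (?u m \<tau>)\<bar> \<le> M * B m"
            by (intro mult_mono c d uB \<tau> abs_ge_zero \<open>0 \<le> M\<close>)+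
          then show ?thesis
            using abs_triangle_ineq[of "c \<tau> * fst (?u m \<tau>)" "d \<tau> * snd (?u m \<tau>)"]
            by (simp add: Suc w'_def B'_def abs_mult)
        qed (simp add: w'_def B'_def)
        have "summable (\<lambda>n. B' (Suc n))" unfolding B'_def nat.case by (intro summable_mult sumB)
        then show "summable B'" by (simp only: summable_Suc_iff)
      qed
      moreover have tb: "t \<in> {t0..b}" using t by (simp add: b_def)
      ultimately have "\<exists>g. \<forall>\<tau>\<in>{t0..b}. (\<lambda>n. w n \<tau>) sums g \<tau> \<and>
          (g has_real_derivative (\<Sum>i. w' i \<tau>)) (at \<tau> within {t0..b})"
        using der wsum by (intro has_field_derivative_series[of _ _ w']) auto
      then obtain g where
        g: "\<And>\<tau>. \<tau> \<in> {t0..b} \<Longrightarrow> (\<lambda>n. w n \<tau>) sums g \<tau> \<and>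
              (g has_real_derivative (\<Sum>i. w' i \<tau>)) (at \<tau> within {t0..b})"
        by blast
      have gw: "g \<tau> = (\<Sum>n. w n \<tau>)" if "\<tau> \<in> {t0..b}" for \<tau>
        using g[OF that] by (simp add: sums_iff)
      have "summable (\<lambda>n. w' (Suc n) t)"
        unfolding w'_def nat.case by (intro summable_add summable_mult summ tb)
      then have "summable (\<lambda>n. w' n t)" by (simp only: summable_Suc_iff[of "\<lambda>n. w' n t"])
      moreover have "w' 0 t = 0" by (simp add: w'_def)
      ultimately have "(\<Sum>i. w' i t) = (\<Sum>n. w' (Suc n) t)"
        using suminf_split_head[of "\<lambda>n. w' n t"] by simp
      also have "\<dots> = c t * \<phi> t + d t * \<psi> t"
        unfolding w'_def nat.case \<phi>_def \<psi>_def
        by (simp add: suminf_add[symmetric] suminf_mult summ[OF tb] summable_mult)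
      finally have "(g has_real_derivative c t * \<phi> t + d t * \<psi> t) (at t within {t0..b})"
        using g[OF tb] by simp
      then have "((\<lambda>t. \<Sum>n. w n t) has_real_derivative c t * \<phi> t + d t * \<psi> t) (at t within {t0..b})"
        by (rule has_field_derivative_transform_within[OF _ zero_less_one tb]) (use gw in auto)
      moreover have "at t within {t0..b} = at t within {t0..}"
        by (rule at_within_nhd[of _ "{..<b}"]) (auto simp: b_def)
      ultimately show ?thesis by simp
    qed
    show ?thesis
    proof
      show "(\<phi> has_real_derivative p t * \<phi> t + q t * \<psi> t) (at t within {t0..})"
        by (subst \<phi>_def, rule component) (use summ cont M in auto)
      show "(\<psi> has_real_derivative r t * \<phi> t + s t * \<psi> t) (at t within {t0..})"
        by (subst \<psi>_def, rule component) (use summ cont M in auto)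
    qed
  qed
  \<comment> \<open>At \<open>t0\<close> every later term is an integral over a single point, so
    only term 0 contributes to the initial value.\<close>
  have start: "fst (?u n t0) = (if n = 0 then x else 0)" "snd (?u n t0) = (if n = 0 then y else 0)" for n
    by (cases n; simp)+
  show thesis
  proof
    show "is_solution t0 p q r s (\<lambda>_. 0) (\<lambda>_. 0) \<phi> \<psi>"
      using deriv by (simp add: is_solution_def)
    show "\<phi> t0 = x" "\<psi> t0 = y"
      using sums_If_finite_set[of "{0}" "\<lambda>_. x"] sums_If_finite_set[of "{0}" "\<lambda>_. y"]
      by (simp_all add: \<phi>_def \<psi>_def start sums_iff)
  qed
qed

section \<open>Initial values at an arbitrary point\<close>

lemma is_solution_combination:
  assumes "is_solution t0 p q r s (\<lambda>_. 0) (\<lambda>_. 0) \<phi>1 \<psi>1"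
    and "is_solution t0 p q r s (\<lambda>_. 0) (\<lambda>_. 0) \<phi>2 \<psi>2"
  shows "is_solution t0 p q r s (\<lambda>_. 0) (\<lambda>_. 0)
    (\<lambda>t. c * \<phi>1 t + d * \<phi>2 t) (\<lambda>t. c * \<psi>1 t + d * \<psi>2 t)"
  using assms unfolding is_solution_def
  by (auto intro!: derivative_eq_intros simp: algebra_simps)

text \<open>Liouville's formula: the Wronskian times \<open>exp (- \<integral>(p + s))\<close> is constant.\<close>

lemma wronskian_nonzero:
  assumes cont: "continuous_on {t0..} p" "continuous_on {t0..} s"
    and sol: "is_solution t0 p q r s (\<lambda>_. 0) (\<lambda>_. 0) \<phi>1 \<psi>1"
      "is_solution t0 p q r s (\<lambda>_. 0) (\<lambda>_. 0) \<phi>2 \<psi>2"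
    and start: "\<phi>1 t0 * \<psi>2 t0 - \<phi>2 t0 * \<psi>1 t0 \<noteq> 0"
    and "t0 \<le> t"
  shows "\<phi>1 t * \<psi>2 t - \<phi>2 t * \<psi>1 t \<noteq> 0"
proof -
  define E where "E t = exp (- integral {t0..t} (\<lambda>\<tau>. p \<tau> + s \<tau>))" for t
  define W where "W t = \<phi>1 t * \<psi>2 t - \<phi>2 t * \<psi>1 t" for t
  have dE: "(E has_real_derivative - (p \<tau> + s \<tau>) * E \<tau>) (at \<tau> within {t0..})" if "t0 \<le> \<tau>" for \<tau>
    unfolding E_def using that
    by (auto intro!: derivative_eq_intros integral_has_real_derivative_atLeast continuous_intros cont)
  have dW: "(W has_real_derivative (p \<tau> + s \<tau>) * W \<tau>) (at \<tau> within {t0..})" if "t0 \<le> \<tau>" for \<tau>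
    unfolding W_def using sol that unfolding is_solution_def
    by (auto intro!: derivative_eq_intros simp: algebra_simps)
  have "((\<lambda>t. W t * E t) has_real_derivative 0) (at \<tau> within {t0..})" if "\<tau> \<in> {t0..}" for \<tau>
    using DERIV_mult[OF dW dE, of \<tau>] that by (simp add: algebra_simps)
  then obtain c where c: "\<And>\<tau>. t0 \<le> \<tau> \<Longrightarrow> W \<tau> * E \<tau> = c"
    using has_field_derivative_zero_constant[of "{t0..}" "\<lambda>t. W t * E t"] by auto
  have "W t * E t = W t0 * E t0" using c \<open>t0 \<le> t\<close> by simp
  then show ?thesis using start by (auto simp: W_def E_def)
qed

text \<open>The solutions starting from the two unit vectors at \<open>t0\<close> have a nonzero
  Wronskian at \<open>a\<close>, so their values there span the plane. The resulting solution lives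
  on all of \<open>{t0..}\<close>, as \<open>oscillatory_on\<close> demands.\<close>

lemma linear_ivp:
  assumes cont: "continuous_on {t0..} p" "continuous_on {t0..} q"
      "continuous_on {t0..} r" "continuous_on {t0..} s"
    and a: "t0 \<le> a"
  obtains \<phi> \<psi> where "is_solution t0 p q r s (\<lambda>_. 0) (\<lambda>_. 0) \<phi> \<psi>" "\<phi> a = x" "\<psi> a = y"
proof -
  obtain \<phi>1 \<psi>1 where 1: "is_solution t0 p q r s (\<lambda>_. 0) (\<lambda>_. 0) \<phi>1 \<psi>1" "\<phi>1 t0 = 1" "\<psi>1 t0 = 0"
    by (rule linear_ivp_at_start[OF cont])
  obtain \<phi>2 \<psi>2 where 2: "is_solution t0 p q r s (\<lambda>_. 0) (\<lambda>_. 0) \<phi>2 \<psi>2" "\<phi>2 t0 = 0" "\<psi>2 t0 = 1"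
    by (rule linear_ivp_at_start[OF cont])
  define W where "W = \<phi>1 a * \<psi>2 a - \<phi>2 a * \<psi>1 a"
  have "W \<noteq> 0"
    unfolding W_def by (rule wronskian_nonzero[OF cont(1,4) 1(1) 2(1) _ a]) (simp add: 1 2)
  \<comment> \<open>Cramer's rule for the combination with value \<open>(x, y)\<close> at
    \<open>a\<close>.\<close>
  define c where "c = (x * \<psi>2 a - y * \<phi>2 a) / W"
  define d where "d = (y * \<phi>1 a - x * \<psi>1 a) / W"
  have "c * \<phi>1 a + d * \<phi>2 a = x * W / W" "c * \<psi>1 a + d * \<psi>2 a = y * W / W"
    unfolding c_def d_def times_divide_eq_left add_divide_distrib[symmetric]
    by (simp_all add: W_def algebra_simps)
  with \<open>W \<noteq> 0\<close> show thesis
    using that[OF is_solution_combination[OF 1(1) 2(1), of c d]] by simp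
qed

section \<open>Sturm-type comparison\<close>

text \<open>Stated for an arbitrary forcing \<open>h\<close>, so that it serves both for
  \<open>\<phi> - alpha\<close> and for its negative.\<close>

lemma not_oscillatory_on_comparison:
  fixes u v h :: "real \<Rightarrow> real"
  assumes cont: "continuous_on {t0..} p" "continuous_on {t0..} q"
      "continuous_on {t0..} r" "continuous_on {t0..} s"
    and q: "\<And>t. t0 \<le> t \<Longrightarrow> 0 \<le> q t"
    and a: "t0 \<le> a"
    and sol: "is_solution t0 p q r s (\<lambda>_. 0) h u v"
    and u: "\<And>t. t \<in> {a..b} \<Longrightarrow> 0 < u t"
    and h: "\<And>t. t \<in> {a..b} \<Longrightarrow> h t \<le> 0"
  shows "\<not> oscillatory_on t0 p q r s (\<lambda>_. 0) (\<lambda>_. 0) a b"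
proof
  assume osc: "oscillatory_on t0 p q r s (\<lambda>_. 0) (\<lambda>_. 0) a b"
  obtain \<phi> \<psi> where \<phi>: "is_solution t0 p q r s (\<lambda>_. 0) (\<lambda>_. 0) \<phi> \<psi>" "\<phi> a = u a" "\<psi> a = v a"
    by (rule linear_ivp[OF cont a])
  \<comment> \<open>\<open>Z\<close> is closed by continuity and nonempty by the assumed
    oscillation, so it contains its infimum: a first zero \<open>c\<close> exists.\<close>
  define Z where "Z = {t \<in> {a..b}. \<phi> t = 0}"
  have "continuous_on {t0..} \<phi>"
    using \<phi>(1) unfolding is_solution_def by (auto intro!: DERIV_continuous_on)
  then have cont\<phi>: "continuous_on {a..b} \<phi>"
    by (rule continuous_on_subset) (use a in auto)
  then have "closed Z"
    unfolding Z_def by (intro continuous_closed_preimage_constant) auto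
  moreover have "Z \<noteq> {}" using osc \<phi>(1) unfolding oscillatory_on_def Z_def by blast
  moreover have bdd: "bdd_below Z" unfolding Z_def by (rule bdd_belowI[of _ a]) auto
  ultimately have "Inf Z \<in> Z" by (intro closed_contains_Inf)
  define c where "c = Inf Z"
  have c: "a \<le> c" "c \<le> b" "\<phi> c = 0" using \<open>Inf Z \<in> Z\<close> by (auto simp: Z_def c_def)
  have nz: "\<phi> t \<noteq> 0" if "a \<le> t" "t < c" for t
    using cInf_lower[OF _ bdd, of t] that c by (auto simp: Z_def c_def)
  have ua: "0 < u a" using u c by auto
  \<comment> \<open>Since \<open>\<phi> a = u a > 0\<close>, a negative value at \<open>t\<close>
    would force a zero in \<open>{a..t}\<close>; this is either earlier than \<open>c\<close> or
    equal to \<open>c = t\<close>, both absurd.\<close>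
  have pos: "0 \<le> \<phi> t" if t: "a \<le> t" "t \<le> c" for t
  proof (rule ccontr)
    assume "\<not> 0 \<le> \<phi> t"
    moreover have "continuous_on {a..t} \<phi>"
      by (rule continuous_on_subset[OF cont\<phi>]) (use t c in auto)
    ultimately obtain z where "a \<le> z" "z \<le> t" "\<phi> z = 0"
      using IVT2'[of \<phi> t 0 a] ua \<phi>(2) t(1) by auto
    with nz[of z] c t \<open>\<not> 0 \<le> \<phi> t\<close> show False by (cases "z = c") auto
  qed

  \<comment> \<open>Integrating factor: it cancels \<open>(p + s) * W\<close>, leaving
    \<open>\<phi> * h * E\<close> as the derivative of \<open>W * E\<close>.\<close>
  define E where "E t = exp (- integral {t0..t} (\<lambda>\<tau>. p \<tau> + s \<tau>))" for t
  define W where "W t = \<phi> t * v t - u t * \<psi> t" for t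
  have dE: "(E has_real_derivative - (p \<tau> + s \<tau>) * E \<tau>) (at \<tau> within {t0..})" if "t0 \<le> \<tau>" for \<tau>
    unfolding E_def using that
    by (auto intro!: derivative_eq_intros integral_has_real_derivative_atLeast continuous_intros cont)
  have dW: "(W has_real_derivative (p \<tau> + s \<tau>) * W \<tau> + \<phi> \<tau> * h \<tau>) (at \<tau> within {t0..})"
    if "t0 \<le> \<tau>" for \<tau>
    unfolding W_def using sol \<phi>(1) that unfolding is_solution_def
    by (auto intro!: derivative_eq_intros simp: algebra_simps)
  have dWE: "((\<lambda>t. W t * E t) has_real_derivative \<phi> \<tau> * h \<tau> * E \<tau>) (at \<tau> within {t0..})"
    if "t0 \<le> \<tau>" for \<tau>
    using DERIV_mult[OF dW dE, of \<tau>] that by (simp add: algebra_simps)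
  \<comment> \<open>\<open>W * E\<close> is nonincreasing because \<open>\<phi>\<close> and
    \<open>h\<close> have opposite signs, and it vanishes at \<open>a\<close>, where the two
    solutions agree.\<close>
  have W: "W t \<le> 0" if t: "a \<le> t" "t \<le> c" for t
  proof -
    have "W t * E t \<le> W a * E a"
    proof (rule DERIV_nonpos_imp_decreasing_open[OF t(1)])
      fix \<tau> assume \<tau>: "a < \<tau>" "\<tau> < t"
      have "\<phi> \<tau> * h \<tau> * E \<tau> \<le> 0"
        using pos[of \<tau>] h[of \<tau>] \<tau> t c by (simp add: E_def mult_nonneg_nonpos mult_nonpos_nonneg)
      then show "\<exists>y. ((\<lambda>t. W t * E t) has_real_derivative y) (at \<tau>) \<and> y \<le> 0"
        using dWE[of \<tau>] \<tau> a by (auto simp: at_within_atLeast_interior)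
    next
      have "continuous_on {t0..} (\<lambda>t. W t * E t)"
        using dWE by (auto intro!: DERIV_continuous_on)
      then show "continuous_on {a..t} (\<lambda>t. W t * E t)"
        by (rule continuous_on_subset) (use a in auto)
    qed
    also have "W a * E a = 0" by (simp add: W_def \<phi>)
    finally show ?thesis by (simp add: E_def mult_le_0_iff)
  qed
  \<comment> \<open>In the quotient rule the terms with \<open>p\<close> cancel, as both first
    equations have the same coefficients and no forcing.\<close>
  have dQ: "((\<lambda>t. \<phi> t / u t) has_real_derivative - q \<tau> * W \<tau> / (u \<tau>)\<^sup>2) (at \<tau> within {t0..})"
    if "\<tau> \<in> {a..c}" for \<tau>
  proof -
    have "u \<tau> \<noteq> 0" using u[of \<tau>] that c by auto
    moreover have "(\<phi> has_real_derivative p \<tau> * \<phi> \<tau> + q \<tau> * \<psi> \<tau>) (at \<tau> within {t0..})"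
      "(u has_real_derivative p \<tau> * u \<tau> + q \<tau> * v \<tau>) (at \<tau> within {t0..})"
      using sol \<phi>(1) that a by (auto simp: is_solution_def)
    ultimately show ?thesis
      by (auto intro!: derivative_eq_intros simp: W_def power2_eq_square algebra_simps)
  qed
  have "\<phi> a / u a \<le> \<phi> c / u c"
  proof (rule DERIV_nonneg_imp_increasing_open[OF c(1)])
    fix \<tau> assume \<tau>: "a < \<tau>" "\<tau> < c"
    have "0 \<le> - q \<tau> * W \<tau> / (u \<tau>)\<^sup>2"
      using q[of \<tau>] W[of \<tau>] \<tau> a by (simp add: mult_nonneg_nonpos divide_nonpos_nonneg)
    then show "\<exists>y. ((\<lambda>t. \<phi> t / u t) has_real_derivative y) (at \<tau>) \<and> 0 \<le> y"
      using dQ[of \<tau>] \<tau> a by (auto simp: at_within_atLeast_interior)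
  next
    show "continuous_on {a..c} (\<lambda>t. \<phi> t / u t)"
      by (rule DERIV_continuous_on[OF DERIV_subset[OF dQ]]) (use a in auto)
  qed
  \<comment> \<open>The quotient is 1 at \<open>a\<close> but 0 at \<open>c\<close>.\<close>
  then show False using \<phi>(2) ua c(3) by simp
qed

section \<open>Removing the forcing from the first equation\<close>

text \<open>Variation of constants: differentiating the bracket yields
  \<open>exp (- integral {t0..t} p) * f t\<close>, whose exponential is cancelled by the outer
  factor.\<close>

lemma alpha_has_real_derivative:
  assumes "continuous_on {t0..} p" "continuous_on {t0..} f" "t0 \<le> t"
  shows "(alpha t0 p f l has_real_derivative p t * alpha t0 p f l t + f t) (at t within {t0..})"
proof -
  have P: "((\<lambda>x. integral {t0..x} p) has_real_derivative p \<tau>) (at \<tau> within {t0..})"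
    if "t0 \<le> \<tau>" for \<tau>
    using assms(1) that by (rule integral_has_real_derivative_atLeast)
  then have "continuous_on {t0..} (\<lambda>x. integral {t0..x} p)"
    by (auto intro!: DERIV_continuous_on)
  then have "continuous_on {t0..} (\<lambda>\<tau>. exp (- integral {t0..\<tau>} p) * f \<tau>)"
    by (intro continuous_intros assms)
  then have F: "((\<lambda>x. integral {t0..x} (\<lambda>\<tau>. exp (- integral {t0..\<tau>} p) * f \<tau>)) has_real_derivative
      exp (- integral {t0..t} p) * f t) (at t within {t0..})"
    using assms(3) by (rule integral_has_real_derivative_atLeast)
  show ?thesis
    unfolding alpha_def[abs_def]
    by (rule derivative_eq_intros P F assms(3) refl)+ (simp add: algebra_simps flip: exp_add)
qed

lemma is_solution_diff_alpha:
  assumes "continuous_on {t0..} p" "continuous_on {t0..} f"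
    and "is_solution t0 p q r s f g \<phi> \<psi>"
  shows "is_solution t0 p q r s (\<lambda>_. 0) (\<lambda>t. r t * alpha t0 p f l t + g t)
    (\<lambda>t. \<phi> t - alpha t0 p f l t) \<psi>"
  using assms(3) unfolding is_solution_def
  by (auto intro!: derivative_eq_intros alpha_has_real_derivative assms(1,2) simp: algebra_simps)

lemma is_solution_uminus:
  assumes "is_solution t0 p q r s f g \<phi> \<psi>"
  shows "is_solution t0 p q r s (\<lambda>t. - f t) (\<lambda>t. - g t) (\<lambda>t. - \<phi> t) (\<lambda>t. - \<psi> t)"
  using assms unfolding is_solution_def
  by (auto intro!: derivative_eq_intros simp: algebra_simps)

section \<open>Sign of a non-oscillating solution and conclusion\<close>

text \<open>The image of the half-line is connected, so values on both sides of 0 would put 0 into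
  it.\<close>

lemma nonzero_constant_sign:
  fixes \<phi> :: "real \<Rightarrow> real"
  assumes "continuous_on {T..} \<phi>" "\<And>t. T \<le> t \<Longrightarrow> \<phi> t \<noteq> 0"
  shows "(\<forall>t\<ge>T. 0 < \<phi> t) \<or> (\<forall>t\<ge>T. \<phi> t < 0)"
proof (rule ccontr)
  assume "\<not> ?thesis"
  then obtain x y where "T \<le> x" "T \<le> y" "\<phi> x \<le> 0" "0 \<le> \<phi> y"
    by (auto simp: not_less)
  moreover have "connected (\<phi> ` {T..})"
    by (intro connected_continuous_image assms(1) convex_connected) auto
  ultimately have "0 \<in> \<phi> ` {T..}"
    by (meson atLeast_iff connectedD_interval imageI)
  then show False using assms(2) by auto
qed

theorem theorem3p2:
  fixes t0 :: real and p q r s f g :: "real \<Rightarrow> real"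
  assumes "continuous_on {t0..} p" "continuous_on {t0..} q" "continuous_on {t0..} r"
    and "continuous_on {t0..} s" "continuous_on {t0..} f" "continuous_on {t0..} g"
    and "\<forall>t\<ge>t0. q t \<ge> 0"
    and "\<forall>T>t0. \<exists>(a :: nat \<Rightarrow> real) (b :: nat \<Rightarrow> real) (l :: real).
           T \<le> a 1 \<and> a 1 < b 1 \<and> b 1 \<le> a 2 \<and> a 2 < b 2 \<and>
           (\<forall>k\<in>{1, 2}.
              (\<forall>t\<in>{a k..b k}. (-1) ^ k * alpha t0 p f l t \<ge> 0) \<and>
              (\<forall>t\<in>{a k..b k}. (-1) ^ k * (r t * alpha t0 p f l t + g t) \<ge> 0) \<and>
              oscillatory_on t0 p q r s (\<lambda>_. 0) (\<lambda>_. 0) (a k) (b k))"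
  shows "oscillatory t0 p q r s f g"
proof (rule ccontr)
  note cont = assms(1-4)
  assume "\<not> oscillatory t0 p q r s f g"
  then obtain \<phi> \<psi> T where sol: "is_solution t0 p q r s f g \<phi> \<psi>" and T: "t0 \<le> T"
    and nz: "\<And>t. T \<le> t \<Longrightarrow> \<phi> t \<noteq> 0"
    unfolding oscillatory_def by blast
  have "continuous_on {t0..} \<phi>"
    using sol unfolding is_solution_def by (auto intro!: DERIV_continuous_on)
  then have "continuous_on {T..} \<phi>"
    by (rule continuous_on_subset) (use T in auto)
  then have sign: "(\<forall>t\<ge>T. 0 < \<phi> t) \<or> (\<forall>t\<ge>T. \<phi> t < 0)"
    using nz by (rule nonzero_constant_sign)
  \<comment> \<open>The hypothesis on intervals needs a threshold strictly above \<open>t0\<close>,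
    whereas \<open>T\<close> may equal \<open>t0\<close>.\<close>
  have "t0 < T + 1" using T by simp
  with assms(8) obtain a b :: "nat \<Rightarrow> real" and l where
    ord: "T + 1 \<le> a 1" "a 1 < b 1" "b 1 \<le> a 2" "a 2 < b 2" and
    k: "\<forall>k\<in>{1, 2}.
              (\<forall>t\<in>{a k..b k}. (-1) ^ k * alpha t0 p f l t \<ge> 0) \<and>
              (\<forall>t\<in>{a k..b k}. (-1) ^ k * (r t * alpha t0 p f l t + g t) \<ge> 0) \<and>
              oscillatory_on t0 p q r s (\<lambda>_. 0) (\<lambda>_. 0) (a k) (b k)"
    by (elim allE[of _ "T + 1"] impE exE conjE) blast+
  note sol' = is_solution_diff_alpha[OF assms(1,5) sol, of l]
  from sign show False
  proof
    assume pos: "\<forall>t\<ge>T. 0 < \<phi> t"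
    \<comment> \<open>For \<open>k = 1\<close> the factor \<open>(-1) ^ k\<close> makes
      \<open>alpha\<close> and the new forcing nonpositive, so subtracting \<open>alpha\<close>
      keeps the first component positive.\<close>
    have "\<not> oscillatory_on t0 p q r s (\<lambda>_. 0) (\<lambda>_. 0) (a 1) (b 1)"
    proof (rule not_oscillatory_on_comparison[OF cont _ _ sol'])
      fix t assume t: "t \<in> {a 1..b 1}"
      then have "0 < \<phi> t" using pos ord by auto
      then show "0 < \<phi> t - alpha t0 p f l t" using k t by fastforce
      show "r t * alpha t0 p f l t + g t \<le> 0" using k t by fastforce
    qed (use assms(7) ord T in auto)
    then show False using k by blast
  next
    assume neg: "\<forall>t\<ge>T. \<phi> t < 0"
    \<comment> \<open>For \<open>k = 2\<close> both are nonnegative, so the negated solution meets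
      the sign conditions. Rewriting with \<open>minus_zero\<close> restores the zero forcing of its
      first equation.\<close>
    have "\<not> oscillatory_on t0 p q r s (\<lambda>_. 0) (\<lambda>_. 0) (a 2) (b 2)"
    proof (rule not_oscillatory_on_comparison[OF cont _ _ is_solution_uminus[OF sol', simplified minus_zero]])
      fix t assume t: "t \<in> {a 2..b 2}"
      then have "\<phi> t < 0" using neg ord by auto
      then show "0 < - (\<phi> t - alpha t0 p f l t)" using k t by fastforce
      show "- (r t * alpha t0 p f l t + g t) \<le> 0" using k t by fastforce
    qed (use assms(7) ord T in auto)
    then show False using k by blast
  qed
qed

end
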